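(* Let $n\ge1$ and let $D$ be an integer such that every collection of $n$ finite sets has discrepancy at most $D$. Suppose $\mathcal B=\{B_1,\dots,B_n\}$ is a collection of $n$ finite sets such that for each $i$, the set of elements of $B_i$ lying in no other $B_j$ ($j\neq i$) has at least $D-1$ elements. Then $\mathcal B$ is $\frac12$-splittable.
   Context: The discrepancy of $\mathcal B=\{B_1,\dots,B_n\}$ is $\min_S\max_{i}\big||B_i\cap S|-|B_i\setminus S|\big|$, the minimum over all sets $S$. The collection is $\frac12$-splittable if there is a set $S$ with $|S\cap B_i|\in\{\lfloor |B_i|/2\rfloor,\lceil |B_i|/2\rceil\}$ for all $i$ (equivalently, discrepancy at most $1$). *)

theory Defs
  imports Complex_Main
begin

text \<open>
  A collection of \<open>n\<close> sets is a family \<open>B\<close> indexed by \<open>{1..n}\<close>; repetitions are allowed and the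
  values of \<open>B\<close> outside \<open>{1..n}\<close> are irrelevant.
\<close>

definition imbalance :: "nat \<Rightarrow> (nat \<Rightarrow> 'a set) \<Rightarrow> 'a set \<Rightarrow> int" where
  "imbalance n B S = (MAX i\<in>{1..n}. \<bar>int (card (B i \<inter> S)) - int (card (B i - S))\<bar>)"

text \<open>
  The minimum ranges over all sets \<open>S\<close>; only finitely many values occur when \<open>n \<ge> 1\<close> and the
  sets are finite (\<open>finite_range_imbalance\<close>), so \<open>Min\<close> is a genuine minimum.
\<close>

definition discrepancy :: "nat \<Rightarrow> (nat \<Rightarrow> 'a set) \<Rightarrow> int" where
  "discrepancy n B = Min (range (imbalance n B))"

text \<open>
  HOL cannot quantify over types inside a formula, so the sets range over the finite sets of
  natural numbers. Lemma \<open>disc_boundD\<close> shows that the bound then holds over every type.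
\<close>

definition disc_bound :: "nat \<Rightarrow> int \<Rightarrow> bool" where
  "disc_bound n D \<longleftrightarrow>
     (\<forall>C :: nat \<Rightarrow> nat set. (\<forall>i\<in>{1..n}. finite (C i)) \<longrightarrow> discrepancy n C \<le> D)"

definition half_splittable :: "nat \<Rightarrow> (nat \<Rightarrow> 'a set) \<Rightarrow> bool" where
  "half_splittable n B \<longleftrightarrow>
     (\<exists>S. \<forall>i\<in>{1..n}. int (card (S \<inter> B i)) \<in>
        {\<lfloor>real (card (B i)) / 2\<rfloor>, \<lceil>real (card (B i)) / 2\<rceil>})"

definition private_part :: "nat \<Rightarrow> (nat \<Rightarrow> 'a set) \<Rightarrow> nat \<Rightarrow> 'a set" where
  "private_part n B i = {x \<in> B i. \<forall>j\<in>{1..n}. j \<noteq> i \<longrightarrow> x \<notin> B j}"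

lemma finite_range_imbalance:
  assumes n: "n \<ge> 1" and fin: "\<forall>i\<in>{1..n}. finite (B i)"
  shows "finite (range (imbalance n B))"
proof -
  let ?U = "\<Union>i\<in>{1..n}. B i"
  have finU: "finite ?U" using fin by blast
  have "imbalance n B S \<in> imbalance n B ` Pow ?U" for S
  proof
    have "B i \<inter> (S \<inter> ?U) = B i \<inter> S \<and> B i - (S \<inter> ?U) = B i - S" if "i \<in> {1..n}" for i
      using that by auto
    then show "imbalance n B S = imbalance n B (S \<inter> ?U)"
      unfolding imbalance_def by (intro arg_cong[where f = Max] image_cong refl) simp
    show "S \<inter> ?U \<in> Pow ?U" by simp
  qed
  then have "range (imbalance n B) \<subseteq> imbalance n B ` Pow ?U" by blast
  then show ?thesis by (rule finite_subset) (rule finite_imageI, use finU in simp)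
qed

lemma discrepancy_le_iff:
  assumes "n \<ge> 1" and "\<forall>i\<in>{1..n}. finite (B i)"
  shows "discrepancy n B \<le> D \<longleftrightarrow>
    (\<exists>S. \<forall>i\<in>{1..n}. \<bar>int (card (B i \<inter> S)) - int (card (B i - S))\<bar> \<le> D)"
proof -
  have "discrepancy n B \<le> D \<longleftrightarrow> (\<exists>S. imbalance n B S \<le> D)"
    unfolding discrepancy_def using finite_range_imbalance[OF assms] by (subst Min_le_iff) simp_all
  moreover have "imbalance n B S \<le> D \<longleftrightarrow>
      (\<forall>i\<in>{1..n}. \<bar>int (card (B i \<inter> S)) - int (card (B i - S))\<bar> \<le> D)" for S
    unfolding imbalance_def using assms(1) by (subst Max_le_iff) simp_all
  ultimately show ?thesis by simp
qed

lemma disc_boundD: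
  fixes B :: "nat \<Rightarrow> 'a set"
  assumes D: "disc_bound n D" and n: "n \<ge> 1" and fin: "\<forall>i\<in>{1..n}. finite (B i)"
  shows "discrepancy n B \<le> D"
proof -
  let ?U = "\<Union>i\<in>{1..n}. B i"
  have "finite ?U" using fin by blast
  then obtain f :: "'a \<Rightarrow> nat" where f: "inj_on f ?U"
    using finite_imp_inj_to_nat_seg by metis
  have finC: "\<forall>i\<in>{1..n}. finite (f ` B i)" using fin by blast
  have "discrepancy n (\<lambda>i. f ` B i) \<le> D"
    by (rule D[unfolded disc_bound_def, THEN spec, THEN mp]) (fact finC)
  then obtain S where S:
    "\<forall>i\<in>{1..n}. \<bar>int (card (f ` B i \<inter> S)) - int (card (f ` B i - S))\<bar> \<le> D"
    using discrepancy_le_iff[OF n finC, THEN iffD1] by auto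
  have "card (f ` B i \<inter> S) = card (B i \<inter> f -` S) \<and> card (f ` B i - S) = card (B i - f -` S)"
    if "i \<in> {1..n}" for i
  proof -
    have inj: "inj_on f (B i)" by (rule inj_on_subset[OF f]) (use that in blast)
    have "f ` B i \<inter> S = f ` (B i \<inter> f -` S)" "f ` B i - S = f ` (B i - f -` S)" by auto
    moreover have "inj_on f (B i \<inter> f -` S)" "inj_on f (B i - f -` S)"
      using inj by (auto intro: inj_on_subset)
    ultimately show ?thesis by (simp only: card_image)
  qed
  with S have "\<forall>i\<in>{1..n}. \<bar>int (card (B i \<inter> f -` S)) - int (card (B i - f -` S))\<bar> \<le> D"
    by simp
  then show ?thesis unfolding discrepancy_le_iff[OF n fin] by (rule exI)
qed

end

theory Submission
  imports Defs
begin

text \<open>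
  Colour the elements that are not private with discrepancy at most \<open>D\<close>. Each set then has
  imbalance at most \<open>D\<close>, and its own private elements, at least \<open>D - 1\<close> in number, can be
  coloured independently of the other sets so as to bring the imbalance down to at most 1.
\<close>

text \<open>As \<open>q\<close> runs through 0..\<open>p\<close>, \<open>a + q\<close> takes every
  value from \<open>a\<close> to \<open>a + p\<close>. The hypothesis makes this range meet the
  floor or the ceiling of half the total; the slack of 1 is what rounding an odd total
  allows.\<close>

lemma balancing_count_exists:
  fixes a b p :: nat
  assumes "\<bar>int a - int b\<bar> \<le> int p + 1"
  obtains q where "q \<le> p"
    and "int (a + q) \<in> {\<lfloor>real (a + b + p) / 2\<rfloor>, \<lceil>real (a + b + p) / 2\<rceil>}"
proof -
  define m where "m = a + b + p"
  have half: "\<lfloor>real m / 2\<rfloor> = int (m div 2)" "\<lceil>real m / 2\<rceil> = int ((m + 1) div 2)"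
    by linarith+
  show thesis
  proof (cases "a \<le> m div 2")
    case True
    show thesis
    proof (rule that)
      \<comment> \<open>Equivalent to \<open>m div 2 \<le> a + p\<close>, which follows from
        \<open>b \<le> a + p + 1\<close> because the floor absorbs the extra 1.\<close>
      show "m div 2 - a \<le> p"
        using assms unfolding m_def by linarith
      show "int (a + (m div 2 - a)) \<in> {\<lfloor>real (a + b + p) / 2\<rfloor>, \<lceil>real (a + b + p) / 2\<rceil>}"
        using True half unfolding m_def by simp
    qed
  next
    case False
    \<comment> \<open>Here \<open>a \<ge> b + p + 1\<close>, so the hypothesis forces equality and
      \<open>m = 2 * a - 1\<close>. Thus \<open>a\<close> is already the rounded-up half and
      \<open>q = 0\<close> works.\<close>
    then have "a = (m + 1) div 2"
      using assms unfolding m_def by linarith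
    then show thesis
      using that[of 0] half unfolding m_def by simp
  qed
qed

theorem theorem4p4:
  fixes n :: nat and D :: int and B :: "nat \<Rightarrow> 'a set"
  assumes "n \<ge> 1"
    and "disc_bound n D"
    and "\<forall>i\<in>{1..n}. finite (B i)"
    and "\<forall>i\<in>{1..n}. int (card (private_part n B i)) \<ge> D - 1"
  shows "half_splittable n B"
proof -
  define P where "P = private_part n B"
  define R where "R i = B i - P i" for i
  have P_sub: "P i \<subseteq> B i" for i
    unfolding P_def private_part_def by blast
  have finR: "\<forall>i\<in>{1..n}. finite (R i)"
    using assms(3) unfolding R_def by blast
  obtain T where T: "\<forall>i\<in>{1..n}. \<bar>int (card (R i \<inter> T)) - int (card (R i - T))\<bar> \<le> D"
    using disc_boundD[OF assms(2,1) finR] discrepancy_le_iff[OF assms(1) finR] by blast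
  have "\<exists>Q. Q \<subseteq> P i \<and> int (card (R i \<inter> T) + card Q) \<in>
      {\<lfloor>real (card (B i)) / 2\<rfloor>, \<lceil>real (card (B i)) / 2\<rceil>}" if i: "i \<in> {1..n}" for i
  proof -
    have finB: "finite (B i)"
      using assms(3) i by blast
    have "card (B i) = card (R i) + card (P i)"
      unfolding R_def using finB P_sub
      by (metis card_Diff_subset card_mono finite_subset le_add_diff_inverse2)
    moreover have "card (R i) = card (R i \<inter> T) + card (R i - T)"
      using card_Int_Diff finR i by blast
    ultimately have cardB: "card (B i) = card (R i \<inter> T) + card (R i - T) + card (P i)"
      by simp
    \<comment> \<open>The threshold \<open>D - 1\<close> enters here: it gives
      \<open>D \<le> card (P i) + 1\<close>.\<close>
    have "\<bar>int (card (R i \<inter> T)) - int (card (R i - T))\<bar> \<le> int (card (P i)) + 1"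
      using T assms(4) i unfolding P_def by force
    then obtain q where "q \<le> card (P i)" and q: "int (card (R i \<inter> T) + q) \<in>
        {\<lfloor>real (card (B i)) / 2\<rfloor>, \<lceil>real (card (B i)) / 2\<rceil>}"
      unfolding cardB by (rule balancing_count_exists)
    then obtain Q where "Q \<subseteq> P i" "card Q = q"
      using obtain_subset_with_card_n by metis
    with q show ?thesis
      by blast
  qed
  then obtain Q where Q_sub: "\<And>i. i \<in> {1..n} \<Longrightarrow> Q i \<subseteq> P i"
    and Q: "\<And>i. i \<in> {1..n} \<Longrightarrow> int (card (R i \<inter> T) + card (Q i)) \<in>
      {\<lfloor>real (card (B i)) / 2\<rfloor>, \<lceil>real (card (B i)) / 2\<rceil>}"
    by metis
  \<comment> \<open>\<open>T\<close> may contain private elements, so these are discarded before the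
    chosen ones are put in.\<close>
  define S where "S = (T - (\<Union>i\<in>{1..n}. P i)) \<union> (\<Union>i\<in>{1..n}. Q i)"
  \<comment> \<open>No other private part meets \<open>B i\<close>, so the choices
    \<open>Q j\<close> with \<open>j \<noteq> i\<close> cannot disturb its count.\<close>
  have P_private: "j = i" if "x \<in> P j" "x \<in> B i" "i \<in> {1..n}" for x i j
    using that unfolding P_def private_part_def by auto
  have "card (S \<inter> B i) = card (R i \<inter> T) + card (Q i)" if i: "i \<in> {1..n}" for i
  proof -
    \<comment> \<open>Stated for a general family \<open>F\<close> because it is applied both to
      \<open>P\<close> (elements removed) and to \<open>Q\<close> (elements added).\<close>
    have UN_Int: "(\<Union>j\<in>{1..n}. F j) \<inter> B i = F i" if F: "\<And>j. j \<in> {1..n} \<Longrightarrow> F j \<subseteq> P j" for F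
    proof (intro equalityI subsetI)
      fix x
      assume "x \<in> (\<Union>j\<in>{1..n}. F j) \<inter> B i"
      then obtain j where j: "j \<in> {1..n}" "x \<in> F j" "x \<in> B i"
        by blast
      then have "j = i"
        using F P_private i by (meson subsetD)
      with j show "x \<in> F i"
        by simp
    next
      fix x
      assume "x \<in> F i"
      then show "x \<in> (\<Union>j\<in>{1..n}. F j) \<inter> B i"
        using F[OF i] P_sub i by blast
    qed
    \<comment> \<open>Each union is intersected with \<open>B i\<close> so that
      \<open>UN_Int\<close> can collapse it to its \<open>i\<close>-th member.\<close>
    have "S \<inter> B i = (B i - (\<Union>j\<in>{1..n}. P j) \<inter> B i) \<inter> T \<union> (\<Union>j\<in>{1..n}. Q j) \<inter> B i"
      unfolding S_def by blast
    also have "\<dots> = (R i \<inter> T) \<union> Q i"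
      unfolding R_def by (simp only: UN_Int[OF subset_refl] UN_Int[OF Q_sub])
    finally have "S \<inter> B i = (R i \<inter> T) \<union> Q i" .
    moreover have "finite (Q i)"
      using Q_sub[OF i] P_sub assms(3) i by (meson finite_subset)
    moreover have "(R i \<inter> T) \<inter> Q i = {}"
      using Q_sub[OF i] unfolding R_def by blast
    ultimately show ?thesis
      using finR i by (simp add: card_Un_disjoint)
  qed
  with Q show ?thesis
    unfolding half_splittable_def by metis
qed

end
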